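(* An $\epsilon$-perfect allocation for two players can be computed with $O(\log\frac1\epsilon)$ queries in the Robertson–Webb (RW) model. That is, there are constants $C>0$ and $\epsilon_0\in(0,1)$ such that for every $0<\epsilon<\epsilon_0$ there is a deterministic RW protocol which, for every choice of value densities $v_1,v_2$ of the two players, asks at most $C\log\frac1\epsilon$ queries and outputs an $\epsilon$-perfect allocation.
   Context: Cake cutting model. The cake is $[0,1]$ and the players are $N=\{1,\dots,n\}$ (here $n=2$). Player $i$ has a private non-negative integrable value density $v_i$ on $[0,1]$ with $\int_0^1 v_i=1$, and values a measurable set $S$ at $V_i(S)=\int_S v_i(x)\,dx$. A piece is a finite union of disjoint intervals (shared endpoints are irrelevant, since sets of measure zero are worth zero). An allocation $A=(A_1,\dots,A_n)$ is a partition of $[0,1]$ into pieces, player $i$ receiving $A_i$. It is $\epsilon$-perfect if $|V_i(A_j)-1/n|\le\epsilon$ for all $i,j\in N$. RW model. A protocol, not knowing the densities, adaptively asks the players queries of two types: $\mathrm{Cut}_i(\alpha)$, for any $\alpha\in[0,1]$: player $i$ returns a point $y$ with $V_i([0,y])=\alpha$ (ties resolved deterministically, e.g. the leftmost such point), and $y$ becomes a cut point; $\mathrm{Eval}_i(y)$, for a previously made cut point $y$: player $i$ returns $V_i([0,y])$. At the end the protocol outputs an allocation demarcated by cut points discovered through its queries. Protocols are deterministic and the number of queries is counted in the worst case over instances. *)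

theory Defs
  imports "HOL-Analysis.Analysis"
begin

definition val :: "(real \<Rightarrow> real) \<Rightarrow> real set \<Rightarrow> real" where
  "val f S = (LINT x:S|lebesgue. f x)"

definition density :: "(real \<Rightarrow> real) \<Rightarrow> bool" where
  "density f \<longleftrightarrow>
     (\<forall>x\<in>{0..1}. 0 \<le> f x) \<and> set_integrable lebesgue {0..1} f \<and> val f {0..1} = 1"

text \<open>Players are the numbers \<open>1, \<dots>, n\<close>; an instance assigns a density to each of them.\<close>

definition cake_instance :: "nat \<Rightarrow> (nat \<Rightarrow> real \<Rightarrow> real) \<Rightarrow> bool" where
  "cake_instance n v \<longleftrightarrow> (\<forall>i\<in>{1..n}. density (v i))"

text \<open>
  Finite unions of disjoint intervals all of whose endpoints lie in \<open>E\<close>.  Each interval may be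
  open, closed or half-open, and may degenerate to a point or to the empty set.
\<close>

definition piece_with_endpoints :: "real set \<Rightarrow> real set \<Rightarrow> bool" where
  "piece_with_endpoints E S \<longleftrightarrow>
     (\<exists>F. finite F \<and> disjoint F \<and> \<Union>F = S \<and>
        (\<forall>I\<in>F. \<exists>a\<in>E. \<exists>b\<in>E. a \<le> b \<and> {a<..<b} \<subseteq> I \<and> I \<subseteq> {a..b}))"

abbreviation piece :: "real set \<Rightarrow> bool" where
  "piece \<equiv> piece_with_endpoints {0..1}"

definition allocation :: "nat \<Rightarrow> (nat \<Rightarrow> real set) \<Rightarrow> bool" where
  "allocation n A \<longleftrightarrow>
     (\<forall>i\<in>{1..n}. piece (A i)) \<and> disjoint_family_on A {1..n} \<and> (\<Union>i\<in>{1..n}. A i) = {0..1}"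

definition perfect :: "real \<Rightarrow> nat \<Rightarrow> (nat \<Rightarrow> real \<Rightarrow> real) \<Rightarrow> (nat \<Rightarrow> real set) \<Rightarrow> bool" where
  "perfect \<epsilon> n v A \<longleftrightarrow>
     allocation n A \<and> (\<forall>i\<in>{1..n}. \<forall>j\<in>{1..n}. \<bar>val (v i) (A j) - 1 / real n\<bar> \<le> \<epsilon>)"

text \<open>
  A deterministic protocol is a decision tree that branches on the (real) answers to its queries.
  Branches may be infinite in number but each of them is finite, so every execution stops.
\<close>

datatype protocol =
    Output "nat \<Rightarrow> real set"
  | Cut nat real "real \<Rightarrow> protocol"
  | Eval nat real "real \<Rightarrow> protocol"

text \<open>
  The point returned by player \<open>i\<close> with density \<open>f\<close> on a cut query at \<open>\<alpha>\<close> need not be unique.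
  A cut rule is a deterministic way of choosing it, for instance the leftmost one
  (lemma \<open>cut_rule_leftmost\<close> below).
\<close>

definition cut_rule :: "(nat \<Rightarrow> (real \<Rightarrow> real) \<Rightarrow> real \<Rightarrow> real) \<Rightarrow> bool" where
  "cut_rule c \<longleftrightarrow>
     (\<forall>i f \<alpha>. density f \<longrightarrow> \<alpha> \<in> {0..1} \<longrightarrow> c i f \<alpha> \<in> {0..1} \<and> val f {0..c i f \<alpha>} = \<alpha>)"

lemma cut_rule_leftmost: "cut_rule (\<lambda>i f \<alpha>. Inf {y\<in>{0..1}. val f {0..y} = \<alpha>})"
  unfolding cut_rule_def
proof (intro allI impI)
  fix f :: "real \<Rightarrow> real" and \<alpha> :: real
  assume f: "density f" and \<alpha>: "\<alpha> \<in> {0..1}"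
  let ?Y = "{y\<in>{0..1}. val f {0..y} = \<alpha>}"
  have int: "set_integrable lebesgue {0..1} f"
    using f by (simp add: density_def)
  then have on: "f integrable_on {0..1}"
    by (rule set_lebesgue_integral_eq_integral(1))
  have eq: "val f {0..y} = integral {0..y} f" if "y \<in> {0..1}" for y
  proof -
    have "set_integrable lebesgue {0..y} f"
      by (rule set_integrable_subset[OF int]) (use that in auto)
    then show ?thesis
      unfolding val_def by (rule set_lebesgue_integral_eq_integral(2))
  qed
  have "continuous_on {0..1} (\<lambda>y. integral {0..y} f)"
    using on by (rule indefinite_integral_continuous_1)
  then have cont: "continuous_on {0..1} (\<lambda>y. val f {0..y})"
    by (rule continuous_on_eq) (simp add: eq)
  have v0: "val f {0..0} = 0" using eq[of 0] by simp
  have v1: "val f {0..1} = 1" using f by (simp add: density_def)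
  have "\<exists>y. 0 \<le> y \<and> y \<le> 1 \<and> val f {0..y} = \<alpha>"
    by (rule IVT'[where f = "\<lambda>y. val f {0..y}"]) (use \<alpha> v0 v1 cont in auto)
  then have ne: "?Y \<noteq> {}" by auto
  have "closed ?Y"
    using continuous_closed_preimage[OF cont closed_atLeastAtMost, of "{\<alpha>}"]
    by (simp add: vimage_def Int_def)
  moreover have "bdd_below ?Y" by (rule bdd_belowI[of _ 0]) auto
  ultimately have "Inf ?Y \<in> ?Y"
    using ne by (intro closed_contains_Inf)
  then show "Inf ?Y \<in> {0..1} \<and> val f {0..Inf ?Y} = \<alpha>" by blast
qed

text \<open>
  The following three functions describe the execution of a protocol on the instance \<open>v\<close>, with
  cut queries answered according to \<open>c\<close>.  The argument \<open>K\<close> of \<open>legal\<close> is the set of cut points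
  made so far.
\<close>

primrec outcome ::
    "(nat \<Rightarrow> (real \<Rightarrow> real) \<Rightarrow> real \<Rightarrow> real) \<Rightarrow> (nat \<Rightarrow> real \<Rightarrow> real) \<Rightarrow> protocol \<Rightarrow> nat \<Rightarrow> real set" where
  "outcome c v (Output A) = A"
| "outcome c v (Cut i \<alpha> P) = outcome c v (P (c i (v i) \<alpha>))"
| "outcome c v (Eval i y P) = outcome c v (P (val (v i) {0..y}))"

primrec queries ::
    "(nat \<Rightarrow> (real \<Rightarrow> real) \<Rightarrow> real \<Rightarrow> real) \<Rightarrow> (nat \<Rightarrow> real \<Rightarrow> real) \<Rightarrow> protocol \<Rightarrow> nat" where
  "queries c v (Output A) = 0"
| "queries c v (Cut i \<alpha> P) = Suc (queries c v (P (c i (v i) \<alpha>)))"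
| "queries c v (Eval i y P) = Suc (queries c v (P (val (v i) {0..y})))"

primrec legal ::
    "(nat \<Rightarrow> (real \<Rightarrow> real) \<Rightarrow> real \<Rightarrow> real) \<Rightarrow> nat \<Rightarrow> (nat \<Rightarrow> real \<Rightarrow> real) \<Rightarrow> protocol \<Rightarrow> real set \<Rightarrow> bool" where
  "legal c n v (Output A) K \<longleftrightarrow>
     allocation n A \<and> (\<forall>i\<in>{1..n}. piece_with_endpoints (K \<union> {0, 1}) (A i))"
| "legal c n v (Cut i \<alpha> P) K \<longleftrightarrow>
     i \<in> {1..n} \<and> \<alpha> \<in> {0..1} \<and>
     legal c n v (P (c i (v i) \<alpha>)) (insert (c i (v i) \<alpha>) K)"
| "legal c n v (Eval i y P) K \<longleftrightarrow>
     i \<in> {1..n} \<and> y \<in> K \<and> legal c n v (P (val (v i) {0..y})) K"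

definition rw_protocol :: "(nat \<Rightarrow> (real \<Rightarrow> real) \<Rightarrow> real \<Rightarrow> real) \<Rightarrow> nat \<Rightarrow> protocol \<Rightarrow> bool" where
  "rw_protocol c n P \<longleftrightarrow> (\<forall>v. cake_instance n v \<longrightarrow> legal c n v P {})"

end

theory Submission imports Defs begin

text \<open>
  Let \<open>x\<close> and \<open>y\<close> be the points where player 1 has value \<open>a\<close> and \<open>a + 1/2\<close> to the left, so that
  \<open>[x, y]\<close> is worth \<open>1/2\<close> to player 1 for every \<open>a\<close> in \<open>[0, 1/2]\<close>.  The intervals for \<open>a = 0\<close> and
  \<open>a = 1/2\<close> can be taken to be complementary, so their values to player 2 lie on different sides
  of \<open>1/2\<close>.  Bisection in \<open>a\<close> preserves this and brings the two ends \<open>(x, y)\<close> and \<open>(x', y')\<close>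
  within \<open>\<epsilon>\<close> of each other as seen by player 1.  Player 2 may still see a large difference, because
  the cuts of player 1 jump where his density vanishes.  But moving a single end of \<open>[x, y]\<close>, from
  \<open>y\<close> to \<open>y'\<close> or from \<open>x\<close> to \<open>x'\<close>, already takes the value of player 2 through \<open>1/2\<close>, and one cut
  by player 2 finds the place, while the value for player 1 changes by at most \<open>\<epsilon>\<close>.
\<close>

text \<open>Keeps player number \<open>1\<close> from being rewritten to
  \<open>Suc 0\<close>.\<close>

declare One_nat_def [simp del]

section \<open>Interval values and the cumulative value function\<close>

abbreviation cdf :: "(real \<Rightarrow> real) \<Rightarrow> real \<Rightarrow> real" where
  "cdf f y \<equiv> val f {0..y}"

lemma density_set_integrable:
  assumes "density f" "S \<subseteq> {0..1}" "S \<in> sets lebesgue"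
  shows "set_integrable lebesgue S f"
  using assms by (auto simp: density_def intro: set_integrable_subset)

lemma val_Un:
  assumes "density f" "S \<subseteq> {0..1}" "T \<subseteq> {0..1}" "S \<in> sets lebesgue" "T \<in> sets lebesgue"
    and "S \<inter> T = {}"
  shows "val f (S \<union> T) = val f S + val f T"
  unfolding val_def using assms by (intro set_integral_Un density_set_integrable)

text \<open>The gauge integral is additive over adjacent closed intervals, shared endpoint
  included.\<close>

lemma val_eq_integral:
  assumes "density f" "0 \<le> x" "y \<le> 1"
  shows "val f {x..y} = integral {x..y} f" and "f integrable_on {x..y}"
proof -
  have "set_integrable lebesgue {x..y} f"
    using assms by (intro density_set_integrable) auto
  then show "val f {x..y} = integral {x..y} f" and "f integrable_on {x..y}"
    unfolding val_def by (rule set_lebesgue_integral_eq_integral)+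
qed

lemma val_interval:
  assumes "density f" "0 \<le> x" "x \<le> y" "y \<le> 1"
  shows "val f {x..y} = cdf f y - cdf f x"
  using Henstock_Kurzweil_Integration.integral_combine[of 0 x y f] assms
  by (simp add: val_eq_integral)

lemma val_Diff_interval:
  assumes "density f" "0 \<le> x" "x \<le> y" "y \<le> 1"
  shows "val f ({0..1} - {x..y}) = 1 - val f {x..y}"
proof -
  have "val f ({x..y} \<union> ({0..1} - {x..y})) = val f {x..y} + val f ({0..1} - {x..y})"
    using assms by (intro val_Un) auto
  moreover have "{x..y} \<union> ({0..1} - {x..y}) = {0..1}"
    using assms by auto
  ultimately show ?thesis
    using assms(1) by (simp add: density_def)
qed

lemma cdf_0: "density f \<Longrightarrow> cdf f 0 = 0"
  \<comment> \<open>The instance reads \<open>cdf f 0 = cdf f 0 - cdf f 0\<close>, provided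
    \<open>{0..0}\<close> is not simplified to \<open>{0}\<close>.\<close>
  using val_interval[of f 0 0] by (simp del: atLeastAtMost_singleton)

lemma cdf_1: "density f \<Longrightarrow> cdf f 1 = 1"
  by (simp add: density_def)

lemma cdf_mono:
  assumes "density f" "0 \<le> x" "x \<le> y" "y \<le> 1"
  shows "cdf f x \<le> cdf f y"
proof -
  have "0 \<le> integral {x..y} f"
    using assms by (intro integral_nonneg val_eq_integral) (auto simp: density_def)
  then show ?thesis
    using val_interval[OF assms] assms by (simp add: val_eq_integral)
qed

text \<open>Orders the answers to cuts. Strictness matters: points of equal value may lie in either
  order.\<close>

lemma cdf_less_imp_le:
  assumes "density f" "x \<in> {0..1}" "y \<in> {0..1}" "cdf f x < cdf f y"
  shows "x \<le> y"
  using cdf_mono[OF assms(1), of y x] assms by fastforce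

section \<open>An interval and its complement as an allocation\<close>

definition halves :: "real \<Rightarrow> real \<Rightarrow> nat \<Rightarrow> real set" where
  "halves x y = (\<lambda>i. if i = 1 then {x..y} else {0..1} - {x..y})"

lemma halves_pieces:
  assumes "0 \<le> x" "x \<le> y" "y \<le> 1" "{0, 1, x, y} \<subseteq> E"
  shows "piece_with_endpoints E (halves x y i)"
proof (cases "i = 1")
  case True
  have "\<exists>a\<in>E. \<exists>b\<in>E. a \<le> b \<and> {a<..<b} \<subseteq> {x..y} \<and> {x..y} \<subseteq> {a..b}"
    using assms by (intro bexI[of _ x] bexI[of _ y]) auto
  then show ?thesis
    unfolding piece_with_endpoints_def using True
    by (intro exI[of _ "{{x..y}}"])
      (simp add: halves_def disjoint_def del: atLeastatMost_subset_iff)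
next
  case False
  have "\<exists>a\<in>E. \<exists>b\<in>E. a \<le> b \<and> {a<..<b} \<subseteq> {0..<x} \<and> {0..<x} \<subseteq> {a..b}"
    using assms by (intro bexI[of _ 0] bexI[of _ x]) auto
  moreover have "\<exists>a\<in>E. \<exists>b\<in>E. a \<le> b \<and> {a<..<b} \<subseteq> {y<..1} \<and> {y<..1} \<subseteq> {a..b}"
    using assms by (intro bexI[of _ y] bexI[of _ 1]) auto
  moreover have "disjoint {{0..<x}, {y<..1}}"
    using assms by (auto simp: disjoint_def)
  moreover have "\<Union>{{0..<x}, {y<..1}} = halves x y i"
    using assms False by (auto simp: halves_def)
  ultimately show ?thesis
    unfolding piece_with_endpoints_def by (intro exI[of _ "{{0..<x}, {y<..1}}"]) simp
qed

lemma atLeastAtMost_1_2: "{1..2} = {1, 2::nat}"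
  by auto

lemma halves_allocation:
  assumes "0 \<le> x" "x \<le> y" "y \<le> 1"
  shows "allocation 2 (halves x y)"
  unfolding allocation_def
proof (intro conjI ballI)
  show "piece (halves x y i)" for i
    using assms by (intro halves_pieces) auto
  show "disjoint_family_on (halves x y) {1..2}"
    by (auto simp: disjoint_family_on_def halves_def)
  show "(\<Union>i\<in>{1..2}. halves x y i) = {0..1}"
    unfolding atLeastAtMost_1_2 using assms by (auto simp: halves_def)
qed

text \<open>Complementary pieces deviate from 1/2 by opposite amounts, so one inequality per player
  covers both.\<close>

lemma perfect_halves:
  assumes "cake_instance 2 v" "0 \<le> x" "x \<le> y" "y \<le> 1"
    and "\<bar>cdf (v 1) y - cdf (v 1) x - 1/2\<bar> \<le> \<epsilon>" "\<bar>cdf (v 2) y - cdf (v 2) x - 1/2\<bar> \<le> \<epsilon>"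
  shows "perfect \<epsilon> 2 v (halves x y)"
  unfolding perfect_def
proof (intro conjI ballI)
  show "allocation 2 (halves x y)"
    using assms by (intro halves_allocation)
  fix i j :: nat
  assume i: "i \<in> {1..2}"
  then have "density (v i)"
    using assms(1) by (simp add: cake_instance_def)
  moreover have "\<bar>cdf (v i) y - cdf (v i) x - 1/2\<bar> \<le> \<epsilon>"
    using i assms(5,6) unfolding atLeastAtMost_1_2 by blast
  ultimately show "\<bar>val (v i) (halves x y j) - 1 / real 2\<bar> \<le> \<epsilon>"
    using assms(2-4) val_interval[of "v i" x y] val_Diff_interval[of "v i" x y]
    by (auto simp: halves_def abs_le_iff)
qed

text \<open>
  Clamping deals with ties: a point outside \<open>[a, b]\<close> with the right value has the same value as
  the nearest end of \<open>[a, b]\<close>.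
\<close>

definition clamp_point :: "real \<Rightarrow> real \<Rightarrow> real \<Rightarrow> real" where
  "clamp_point a b z = max a (min b z)"

lemma clamp_point_bounds: "a \<le> b \<Longrightarrow> a \<le> clamp_point a b z \<and> clamp_point a b z \<le> b"
  by (auto simp: clamp_point_def)

lemma clamp_point_in: "clamp_point a b z \<in> {a, b, z}"
  by (auto simp: clamp_point_def max_def min_def)

lemma cdf_clamp_point:
  assumes "density f" "0 \<le> a" "a \<le> b" "b \<le> 1" "z \<in> {0..1}"
    and "cdf f a \<le> cdf f z" "cdf f z \<le> cdf f b"
  shows "cdf f (clamp_point a b z) = cdf f z"
  using assms cdf_mono[OF assms(1), of z a] cdf_mono[OF assms(1), of b z]
  by (auto simp: clamp_point_def max_def min_def)

text \<open>
  The arguments \<open>p\<close> and \<open>q\<close> are the values of player 2 for \<open>[0, x]\<close> and \<open>[0, y]\<close>; they are passed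
  along because \<open>0\<close> and \<open>1\<close> are not cut points and cannot be evaluated.
\<close>

primrec search ::
    "nat \<Rightarrow> real \<Rightarrow> real \<Rightarrow> real \<Rightarrow> real \<Rightarrow> real \<Rightarrow> real \<Rightarrow> real \<Rightarrow> real \<Rightarrow> protocol" where
  "search 0 a d x y x' y' p q =
     (if q - p \<le> 1/2 then Cut 2 (p + 1/2) (\<lambda>z. Output (halves x (clamp_point y y' z)))
      else Cut 2 (q - 1/2) (\<lambda>z. Output (halves (clamp_point x x' z) y)))"
| "search (Suc k) a d x y x' y' p q =
     Cut 1 (a + d/2) (\<lambda>xm. Eval 2 xm (\<lambda>pm.
     Cut 1 (a + d/2 + 1/2) (\<lambda>ym. Eval 2 ym (\<lambda>qm.
       if (qm - pm \<le> 1/2) = (q - p \<le> 1/2) then search k (a + d/2) (d/2) xm ym x' y' pm qm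
       else search k a (d/2) x y xm ym p q))))"

text \<open>\<open>f\<close> belongs to player 1, \<open>g\<close> to player 2. Because
  \<open>x' \<le> y\<close>, either end can move alone without crossing the other. The last line is
  the sign change, split by the test made in \<open>search\<close>.\<close>

definition bracket ::
    "(real \<Rightarrow> real) \<Rightarrow> (real \<Rightarrow> real) \<Rightarrow> real \<Rightarrow> real \<Rightarrow> real \<Rightarrow> real \<Rightarrow> real \<Rightarrow> real \<Rightarrow> bool" where
  "bracket f g a d x y x' y' \<longleftrightarrow>
     0 \<le> a \<and> 0 < d \<and> a + d \<le> 1/2 \<and>
     0 \<le> x \<and> x \<le> x' \<and> x' \<le> y \<and> y \<le> y' \<and> y' \<le> 1 \<and>
     cdf f x = a \<and> cdf f y = a + 1/2 \<and> cdf f x' = a + d \<and> cdf f y' = a + d + 1/2 \<and>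
     (if cdf g y - cdf g x \<le> 1/2 then 1/2 \<le> cdf g y' - cdf g x' else cdf g y' - cdf g x' \<le> 1/2)"

lemma bracket_bisect:
  assumes br: "bracket f g a d x y x' y'" and f: "density f"
    and xm: "xm \<in> {0..1}" "cdf f xm = a + d/2" and ym: "ym \<in> {0..1}" "cdf f ym = a + d/2 + 1/2"
  shows "if (cdf g ym - cdf g xm \<le> 1/2) = (cdf g y - cdf g x \<le> 1/2)
    then bracket f g (a + d/2) (d/2) xm ym x' y' else bracket f g a (d/2) x y xm ym"
proof -
  \<comment> \<open>As \<open>0 < d\<close>, the values of player 1 at these points differ strictly.
    The order \<open>x' \<le> ym\<close> or \<open>xm \<le> y\<close> then follows through
    \<open>x' \<le> y\<close>.\<close>
  have "x \<le> xm" "xm \<le> x'" "y \<le> ym" "ym \<le> y'"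
    using br xm ym by (auto intro!: cdf_less_imp_le[OF f] simp: bracket_def)
  then show ?thesis
    using br xm ym by (auto simp: bracket_def)
qed

text \<open>If \<open>[x, y]\<close> is worth at most 1/2 to player 2, then \<open>[x, y']\<close>
  is worth at least 1/2, since it contains \<open>[x', y']\<close>. Otherwise \<open>[x', y]\<close>
  is worth at most 1/2, since it lies in \<open>[x', y']\<close>. So player 2 sees exactly 1/2 after
  the clamped cut, and player 1 is off by at most \<open>d\<close>.\<close>

lemma bracket_finish:
  assumes br: "bracket (v 1) (v 2) a d x y x' y'" and v: "cake_instance 2 v"
    and "d \<le> \<epsilon>" and z: "z \<in> {0..1}"
  shows "cdf (v 2) y - cdf (v 2) x \<le> 1/2 \<Longrightarrow> cdf (v 2) z = cdf (v 2) x + 1/2 \<Longrightarrow>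
      perfect \<epsilon> 2 v (halves x (clamp_point y y' z))" (is "?A \<Longrightarrow> ?B \<Longrightarrow> _")
    and "\<not> cdf (v 2) y - cdf (v 2) x \<le> 1/2 \<Longrightarrow> cdf (v 2) z = cdf (v 2) y - 1/2 \<Longrightarrow>
      perfect \<epsilon> 2 v (halves (clamp_point x x' z) y)" (is "?C \<Longrightarrow> ?D \<Longrightarrow> _")
proof -
  have v1: "density (v 1)" and v2: "density (v 2)"
    using v by (auto simp: cake_instance_def)
  have pts: "0 \<le> x" "x \<le> x'" "x' \<le> y" "y \<le> y'" "y' \<le> 1"
    using br by (auto simp: bracket_def)
  have mono: "cdf (v 2) x \<le> cdf (v 2) x'" "cdf (v 2) y \<le> cdf (v 2) y'"
    using pts by (auto intro!: cdf_mono[OF v2])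
  { assume A: ?A and B: ?B
    let ?z = "clamp_point y y' z"
    have z: "y \<le> ?z" "?z \<le> y'"
      using clamp_point_bounds pts by auto
    have "cdf (v 2) ?z = cdf (v 2) z"
      using A B br mono pts \<open>z \<in> {0..1}\<close>
      by (intro cdf_clamp_point v2) (auto simp: bracket_def)
    moreover have "cdf (v 1) y \<le> cdf (v 1) ?z" "cdf (v 1) ?z \<le> cdf (v 1) y'"
      using z pts by (auto intro!: cdf_mono[OF v1])
    ultimately show "perfect \<epsilon> 2 v (halves x ?z)"
      using z pts B br \<open>d \<le> \<epsilon>\<close>
      by (intro perfect_halves v) (auto simp: bracket_def) }
  { assume C: ?C and D: ?D
    let ?z = "clamp_point x x' z"
    have z: "x \<le> ?z" "?z \<le> x'"
      using clamp_point_bounds pts by auto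
    have "cdf (v 2) ?z = cdf (v 2) z"
      using C D br mono pts \<open>z \<in> {0..1}\<close>
      by (intro cdf_clamp_point v2) (auto simp: bracket_def)
    moreover have "cdf (v 1) x \<le> cdf (v 1) ?z" "cdf (v 1) ?z \<le> cdf (v 1) x'"
      using z pts by (auto intro!: cdf_mono[OF v1])
    ultimately show "perfect \<epsilon> 2 v (halves ?z y)"
      using z pts D br \<open>d \<le> \<epsilon>\<close>
      by (intro perfect_halves v) (auto simp: bracket_def) }
qed

lemma queries_search: "queries c v (search k a d x y x' y' p q) = 4 * k + 1"
  by (induction k arbitrary: a d x y x' y' p q) auto

text \<open>Each round halves \<open>d\<close>, so \<open>k\<close> rounds bring it down to
  \<open>\<epsilon>\<close>. The outer ends may still be 0 and 1, which need not be in
  \<open>K\<close>.\<close>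

lemma search_correct:
  assumes c: "cut_rule c" and v: "cake_instance 2 v"
    and "bracket (v 1) (v 2) a d x y x' y'" "{x, y, x', y'} \<subseteq> K \<union> {0, 1}" "d \<le> \<epsilon> * 2 ^ k"
    and "P = search k a d x y x' y' (cdf (v 2) x) (cdf (v 2) y)"
  shows "legal c 2 v P K \<and> perfect \<epsilon> 2 v (outcome c v P)"
  using assms(3-)
proof (induction k arbitrary: a d x y x' y' K P)
  case 0
  have v2: "density (v 2)"
    using v by (auto simp: cake_instance_def)
  have pts: "0 \<le> x" "x \<le> x'" "x' \<le> y" "y \<le> y'" "y' \<le> 1"
    using 0 by (auto simp: bracket_def)
  have bounds: "0 \<le> cdf (v 2) x" "cdf (v 2) x \<le> cdf (v 2) x'" "cdf (v 2) y \<le> cdf (v 2) y'"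
      "cdf (v 2) y' \<le> 1"
    using cdf_mono[OF v2, of 0 x] cdf_mono[OF v2, of x x'] cdf_mono[OF v2, of y y']
      cdf_mono[OF v2, of y' 1] pts cdf_0[OF v2] cdf_1[OF v2] by auto
  show ?case
  proof (cases "cdf (v 2) y - cdf (v 2) x \<le> 1/2")
    case True
    let ?\<alpha> = "cdf (v 2) x + 1/2"
    let ?z = "c 2 (v 2) ?\<alpha>"
    let ?A = "halves x (clamp_point y y' ?z)"
    \<comment> \<open>The sign change gives
      \<open>cdf (v 2) x' \<le> cdf (v 2) y' - 1/2 \<le> 1/2\<close>, and \<open>cdf (v 2) x\<close>
      is no larger.\<close>
    have \<alpha>: "?\<alpha> \<in> {0..1}"
      using bounds True 0 by (auto simp: bracket_def)
    then have z: "?z \<in> {0..1}" "cdf (v 2) ?z = ?\<alpha>"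
      using c v2 by (auto simp: cut_rule_def)
    have "perfect \<epsilon> 2 v ?A"
      using 0 True z by (intro bracket_finish(1)[OF _ v]) auto
    moreover have "piece_with_endpoints (insert ?z K \<union> {0, 1}) (?A i)" for i
      using clamp_point_bounds[of y y' ?z] clamp_point_in[of y y' ?z] pts 0
      by (intro halves_pieces) auto
    ultimately show ?thesis
      using \<alpha> True 0 by (auto simp: perfect_def)
  next
    case False
    let ?\<alpha> = "cdf (v 2) y - 1/2"
    let ?z = "c 2 (v 2) ?\<alpha>"
    let ?A = "halves (clamp_point x x' ?z) y"
    have \<alpha>: "?\<alpha> \<in> {0..1}"
      using bounds False 0 by (auto simp: bracket_def)
    then have z: "?z \<in> {0..1}" "cdf (v 2) ?z = ?\<alpha>"
      using c v2 by (auto simp: cut_rule_def)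
    have "perfect \<epsilon> 2 v ?A"
      using 0 False z by (intro bracket_finish(2)[OF _ v]) auto
    moreover have "piece_with_endpoints (insert ?z K \<union> {0, 1}) (?A i)" for i
      using clamp_point_bounds[of x x' ?z] clamp_point_in[of x x' ?z] pts 0
      by (intro halves_pieces) auto
    ultimately show ?thesis
      using \<alpha> False 0 by (auto simp: perfect_def)
  qed
next
  case (Suc k)
  let ?xm = "c 1 (v 1) (a + d/2)" and ?ym = "c 1 (v 1) (a + d/2 + 1/2)"
  let ?K = "insert ?ym (insert ?xm K)"
  have v1: "density (v 1)"
    using v by (auto simp: cake_instance_def)
  have \<alpha>: "a + d/2 \<in> {0..1}" "a + d/2 + 1/2 \<in> {0..1}"
    using Suc.prems(1) by (auto simp: bracket_def)
  then have xm: "?xm \<in> {0..1}" "cdf (v 1) ?xm = a + d/2"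
    and ym: "?ym \<in> {0..1}" "cdf (v 1) ?ym = a + d/2 + 1/2"
    using c v1 by (auto simp: cut_rule_def)
  have d: "d/2 \<le> \<epsilon> * 2 ^ k"
    using Suc.prems(3) by simp
  note bisect = bracket_bisect[OF Suc.prems(1) v1 xm ym]
  show ?case
  proof (cases "(cdf (v 2) ?ym - cdf (v 2) ?xm \<le> 1/2) = (cdf (v 2) y - cdf (v 2) x \<le> 1/2)")
    case True
    let ?Q = "search k (a + d/2) (d/2) ?xm ?ym x' y' (cdf (v 2) ?xm) (cdf (v 2) ?ym)"
    have "legal c 2 v ?Q ?K \<and> perfect \<epsilon> 2 v (outcome c v ?Q)"
      using bisect True Suc.prems(2) d by (intro Suc.IH[OF _ _ _ refl]) auto
    then show ?thesis
      using True \<alpha> unfolding Suc.prems(4) by simp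
  next
    case False
    let ?Q = "search k a (d/2) x y ?xm ?ym (cdf (v 2) x) (cdf (v 2) y)"
    have "legal c 2 v ?Q ?K \<and> perfect \<epsilon> 2 v (outcome c v ?Q)"
      using bisect False Suc.prems(2) d by (intro Suc.IH[OF _ _ _ refl]) auto
    then show ?thesis
      using False \<alpha> unfolding Suc.prems(4) by simp
  qed
qed

text \<open>Starts with \<open>a = 0\<close>, \<open>d = 1/2\<close> and \<open>x' = y = m\<close>,
  so one cut and one evaluation suffice. The outer ends are exactly 0 and 1, whereas cuts at these
  values could differ from them through ties.\<close>

definition perfect_protocol :: "nat \<Rightarrow> protocol" where
  "perfect_protocol k = Cut 1 (1/2) (\<lambda>m. Eval 2 m (\<lambda>q. search k 0 (1/2) 0 m m 1 0 q))"

lemma queries_perfect_protocol: "queries c v (perfect_protocol k) = 4 * k + 3"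
  by (simp add: perfect_protocol_def queries_search)

lemma perfect_protocol_correct:
  assumes c: "cut_rule c" and v: "cake_instance 2 v" and "1/2 \<le> \<epsilon> * 2 ^ k"
  shows "legal c 2 v (perfect_protocol k) {}"
    and "perfect \<epsilon> 2 v (outcome c v (perfect_protocol k))"
proof -
  have v1: "density (v 1)" and v2: "density (v 2)"
    using v by (auto simp: cake_instance_def)
  let ?m = "c 1 (v 1) (1/2)"
  have m: "?m \<in> {0..1}" "cdf (v 1) ?m = 1/2"
    using c v1 by (auto simp: cut_rule_def)
  have "bracket (v 1) (v 2) 0 (1/2) 0 ?m ?m 1"
    using m cdf_0[OF v1] cdf_0[OF v2] cdf_1[OF v1] cdf_1[OF v2]
    by (auto simp: bracket_def simp del: atLeastAtMost_singleton)
  then have "legal c 2 v (search k 0 (1/2) 0 ?m ?m 1 0 (cdf (v 2) ?m)) {?m} \<and>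
      perfect \<epsilon> 2 v (outcome c v (search k 0 (1/2) 0 ?m ?m 1 0 (cdf (v 2) ?m)))"
    using assms(3) cdf_0[OF v2]
    by (intro search_correct[OF c v]) (auto simp del: atLeastAtMost_singleton)
  then show "legal c 2 v (perfect_protocol k) {}"
    and "perfect \<epsilon> 2 v (outcome c v (perfect_protocol k))"
    by (simp_all add: perfect_protocol_def)
qed

theorem theorem5p1:
  fixes c :: "nat \<Rightarrow> (real \<Rightarrow> real) \<Rightarrow> real \<Rightarrow> real"
  assumes "cut_rule c"
  shows "\<exists>C>0. \<exists>\<epsilon>\<^sub>0. 0 < \<epsilon>\<^sub>0 \<and> \<epsilon>\<^sub>0 < 1 \<and>
    (\<forall>\<epsilon>::real. 0 < \<epsilon> \<and> \<epsilon> < \<epsilon>\<^sub>0 \<longrightarrow>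
      (\<exists>P. rw_protocol c 2 P \<and>
        (\<forall>v. cake_instance 2 v \<longrightarrow>
          real (queries c v P) \<le> C * ln (1 / \<epsilon>) \<and> perfect \<epsilon> 2 v (outcome c v P))))"
proof -
  have *: "\<exists>P. rw_protocol c 2 P \<and>
      (\<forall>v. cake_instance 2 v \<longrightarrow>
        real (queries c v P) \<le> 11 / ln 2 * ln (1 / \<epsilon>) \<and> perfect \<epsilon> 2 v (outcome c v P))"
    if \<epsilon>: "0 < \<epsilon> \<and> \<epsilon> < 1/2" for \<epsilon> :: real
  proof -
    define L where "L = log 2 (1 / \<epsilon>)"
    define k where "k = nat \<lceil>L\<rceil>"
    have L: "1 \<le> L"
      using \<epsilon> by (simp add: L_def le_log_iff field_simps)
    then have k: "L \<le> real k" "real k \<le> L + 1"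
      unfolding k_def by linarith+
    have "1 / \<epsilon> \<le> 2 powr real k"
      using \<epsilon> k(1) by (simp add: L_def log_le_iff)
    \<comment> \<open>The initial width is 1/2, and even \<open>\<epsilon> * 2 ^ k \<ge> 1\<close>
      holds.\<close>
    then have bound: "1/2 \<le> \<epsilon> * 2 ^ k"
      using \<epsilon> by (simp add: powr_realpow field_simps)
    \<comment> \<open>\<open>4 * (L + 1) + 3 = 4 * L + 7\<close>, and \<open>1 \<le> L\<close>
      absorbs the 7.\<close>
    have "real (4 * k + 3) \<le> 11 * L"
      using k L by simp
    also have "\<dots> = 11 / ln 2 * ln (1 / \<epsilon>)"
      by (simp add: L_def log_def)
    finally have "real (4 * k + 3) \<le> 11 / ln 2 * ln (1 / \<epsilon>)" .
    then show ?thesis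
      using perfect_protocol_correct[OF assms _ bound]
      by (intro exI[of _ "perfect_protocol k"]) (simp add: rw_protocol_def queries_perfect_protocol)
  qed
  show ?thesis
    by (rule exI[of _ "11 / ln 2"], intro conjI, simp, rule exI[of _ "1/2"]) (use * in simp)
qed

end
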